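(* Let $m_1,m_2\ge 1$ be integers, let $n=m_1+m_2$, and suppose $m_1=\kappa m_2$ for some $\kappa\ge 1$. Let $X_1,\ldots,X_n\in\mathbb{R}$ be fixed, with sample standard deviation $s_n>0$. Let $\pi$ be a random permutation uniformly distributed on the symmetric group $\mathbb{S}_n$, and let $$T(\pi)=\frac{1}{s_n}\left[\frac{1}{m_1}\sum_{i=1}^{m_1}X_{\pi(i)}-\frac{1}{m_2}\sum_{i=m_1+1}^{n}X_{\pi(i)}\right].$$ Then for every $t\ge 0$, $$\mathrm{P}\left(T(\pi)\ge t\right)\le \exp\left(-\frac{n t^2}{2\lceil \kappa+1\rceil^3}\right).$$
   Context: The probability is over the uniform random permutation $\pi$ only, with the data $X_1,\ldots,X_n$ held fixed (i.e. it is conditional on the data): $\mathrm{P}(T(\pi)\ge t)=\frac{1}{n!}\sum_{\pi\in\mathbb{S}_n}\mathbf{1}[T(\pi)\ge t]$. The sample standard deviation of the whole data set is given by $s_n^2=(n-1)^{-1}\sum_{i=1}^n(X_i-\bar X)^2$, where $\bar X=n^{-1}\sum_{i=1}^n X_i$. $\lceil\cdot\rceil$ denotes the ceiling function. *)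

theory Defs
  imports "HOL-Probability.Probability" "HOL-Combinatorics.Permutations"
begin

text \<open>The data \<open>X\<^sub>1, \<dots>, X\<^sub>n\<close> are the values of \<open>X :: nat \<Rightarrow> real\<close> on \<open>{1..n}\<close>; values of \<open>X\<close>
  outside this range are never used.\<close>

definition sample_mean :: "nat \<Rightarrow> (nat \<Rightarrow> real) \<Rightarrow> real" where
  "sample_mean n X = (1 / real n) * (\<Sum>i = 1..n. X i)"

definition sample_sd :: "nat \<Rightarrow> (nat \<Rightarrow> real) \<Rightarrow> real" where
  "sample_sd n X = sqrt ((1 / (real n - 1)) * (\<Sum>i = 1..n. (X i - sample_mean n X)\<^sup>2))"

definition perm_stat :: "nat \<Rightarrow> nat \<Rightarrow> (nat \<Rightarrow> real) \<Rightarrow> (nat \<Rightarrow> nat) \<Rightarrow> real" where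
  "perm_stat m1 m2 X p =
     (1 / sample_sd (m1 + m2) X) *
     ((1 / real m1) * (\<Sum>i = 1..m1. X (p i))
      - (1 / real m2) * (\<Sum>i = m1 + 1..m1 + m2. X (p i)))"

definition uniform_perm :: "nat \<Rightarrow> (nat \<Rightarrow> nat) pmf" where
  "uniform_perm n = pmf_of_set {p. p permutes {1..n}}"

end

theory Submission imports Defs begin

text \<open>
  Let \<open>Y\<close> be the centred data, \<open>V = \<Sum> Y\<^sub>i\<^sup>2\<close>, and let \<open>S(\<pi>)\<close> be the sum of \<open>Y \<circ> \<pi>\<close> over
  the first block, so that \<open>T = n S / (m\<^sub>1 m\<^sub>2 s\<^sub>n)\<close>.  Swapping an index \<open>i\<close> of the first block
  with an index \<open>j\<close> of the second one preserves the uniform distribution and changes \<open>S\<close> by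
  \<open>D\<^sub>i\<^sub>j = Y\<^sub>\<pi>\<^sub>i - Y\<^sub>\<pi>\<^sub>j\<close>.  Since \<open>\<Sum>\<^sub>i\<^sub>j D\<^sub>i\<^sub>j = n S\<close> and
  \<open>\<Sum>\<^sub>i\<^sub>j D\<^sub>i\<^sub>j\<^sup>2 \<le> n V\<close>, this exchangeable pair yields \<open>F' \<le> (\<lambda> V / 2) F\<close> for the moment
  generating function \<open>F(\<lambda>) = E exp (\<lambda> S)\<close>, hence \<open>F(\<lambda>) \<le> exp (\<lambda>\<^sup>2 V / 4)\<close>, and Chernoff's
  bound gives \<open>P(S \<ge> u) \<le> exp (- u\<^sup>2 / V)\<close>.  The claimed estimate then reduces to
  \<open>\<kappa> + 1 \<le> 2 \<kappa>\<^sup>2\<close>.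
\<close>

section \<open>An exponential difference inequality\<close>

text \<open>The trapezoidal rule overestimates the integral of the convex function
  \<open>exp\<close>; equivalently, tanh (d/2) \<le> d/2 for d = x - y \<ge> 0. Both sides are
  symmetric in \<open>x\<close> and \<open>y\<close>, so this case suffices.\<close>

lemma diff_mult_exp_diff_le:
  fixes x y :: real
  shows "(x - y) * (exp x - exp y) \<le> (x - y)\<^sup>2 / 2 * (exp x + exp y)"
proof -
  have nonneg: "0 \<le> d / 2 * (exp d + 1) - (exp d - 1)" if "0 \<le> d" for d :: real
  proof -
    let ?g = "\<lambda>d::real. d / 2 * (exp d + 1) - (exp d - 1)"
    have "?g 0 \<le> ?g d"
    proof (rule DERIV_nonneg_imp_nondecreasing[OF that])
      fix x :: real
      \<comment> \<open>The tangent bound 1 - x \<le> exp (-x), scaled by \<open>exp x\<close>,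
        makes the derivative of \<open>?g\<close> nonnegative.\<close>
      have "exp x * (1 - x) \<le> exp x * exp (- x)"
        using exp_ge_add_one_self[of "- x"] by (intro mult_left_mono) auto
      then have "0 \<le> (1 - exp x + x * exp x) / 2"
        by (simp add: exp_minus algebra_simps)
      moreover have "(?g has_real_derivative (1 - exp x + x * exp x) / 2) (at x)"
        by (auto intro!: derivative_eq_intros simp: field_simps)
      ultimately show "\<exists>y. (?g has_real_derivative y) (at x) \<and> 0 \<le> y"
        by blast
    qed
    then show ?thesis by simp
  qed
  have main: "(a - b) * (exp a - exp b) \<le> (a - b)\<^sup>2 / 2 * (exp a + exp b)"
    if "b \<le> a" for a b :: real
  proof -
    have "0 \<le> (a - b) * exp b * ((a - b) / 2 * (exp (a - b) + 1) - (exp (a - b) - 1))"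
      using nonneg[of "a - b"] that by (intro mult_nonneg_nonneg) auto
    also have "\<dots> = (a - b)\<^sup>2 / 2 * (exp (a - b) * exp b + exp b)
        - (a - b) * (exp (a - b) * exp b - exp b)"
      by (simp add: field_simps power2_eq_square)
    also have "exp (a - b) * exp b = exp a"
      by (simp flip: exp_add)
    finally show ?thesis by simp
  qed
  show ?thesis
  proof (cases "y \<le> x")
    case True
    then show ?thesis by (rule main)
  next
    case False
    then show ?thesis
      using main[of x y] by (simp add: algebra_simps power2_commute)
  qed
qed

section \<open>Sums over permutations and over pairs of indices\<close>

text \<open>Composing with a fixed transposition is an involution on the permutations of
  \<open>A\<close>; this is the exchangeability used below.\<close>

lemma sum_permutes_transpose:
  fixes g :: "('a \<Rightarrow> 'a) \<Rightarrow> 'b::comm_monoid_add"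
  assumes "i \<in> A" "j \<in> A"
  shows "(\<Sum>p | p permutes A. g (p \<circ> Transposition.transpose i j)) = (\<Sum>p | p permutes A. g p)"
  by (rule sum.reindex_bij_witness[where i = "\<lambda>p. p \<circ> Transposition.transpose i j"
        and j = "\<lambda>p. p \<circ> Transposition.transpose i j"])
    (auto simp: comp_assoc intro!: permutes_compose permutes_swap_id assms)

lemma sum_sum_diff:
  fixes y :: "'a \<Rightarrow> real"
  assumes "sum y I + sum y J = 0"
  shows "(\<Sum>i\<in>I. \<Sum>j\<in>J. y i - y j) = (real (card I) + real (card J)) * sum y I"
proof -
  have "(\<Sum>i\<in>I. \<Sum>j\<in>J. y i - y j) = card J * sum y I - card I * sum y J"
    by (simp add: sum_subtractf flip: sum_distrib_left)
  also have "sum y J = - sum y I" using assms by simp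
  finally show ?thesis by (simp add: algebra_simps)
qed

text \<open>As the two sums are opposite, the cross term of the expanded square equals (sum y I)^2 +
  (sum y J)^2, and Cauchy-Schwarz on each block supplies the missing multiples of the sums of
  squares.\<close>

lemma sum_sum_diff_squared_le:
  fixes y :: "'a \<Rightarrow> real"
  assumes "finite I" "finite J" "sum y I + sum y J = 0"
  shows "(\<Sum>i\<in>I. \<Sum>j\<in>J. (y i - y j)\<^sup>2)
    \<le> (real (card I) + real (card J)) * ((\<Sum>i\<in>I. (y i)\<^sup>2) + (\<Sum>j\<in>J. (y j)\<^sup>2))"
proof -
  let ?A = "\<Sum>i\<in>I. (y i)\<^sup>2" and ?B = "\<Sum>j\<in>J. (y j)\<^sup>2"
  have "(\<Sum>i\<in>I. \<Sum>j\<in>J. (y i - y j)\<^sup>2)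
      = (\<Sum>i\<in>I. \<Sum>j\<in>J. (y i)\<^sup>2) + (\<Sum>i\<in>I. \<Sum>j\<in>J. (y j)\<^sup>2) - 2 * (\<Sum>i\<in>I. \<Sum>j\<in>J. y i * y j)"
    by (simp add: power2_diff sum.distrib sum_subtractf sum_distrib_left mult.assoc)
  also have "(\<Sum>i\<in>I. \<Sum>j\<in>J. y i * y j) = sum y I * sum y J"
    by (simp add: sum_product)
  also have "sum y J = - sum y I" using assms by simp
  also have "(\<Sum>i\<in>I. \<Sum>j\<in>J. (y i)\<^sup>2) + (\<Sum>i\<in>I. \<Sum>j\<in>J. (y j)\<^sup>2) - 2 * (sum y I * (- sum y I))
      = card J * ?A + card I * ?B + (sum y I)\<^sup>2 + (sum y J)\<^sup>2"
    using assms(3) by (simp add: eq_neg_iff_add_eq_0 [symmetric] power2_eq_square flip: sum_distrib_left)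
  also have "\<dots> \<le> card J * ?A + card I * ?B + ?A * card I + ?B * card J"
    using sum_squared_le_sum_of_squares[of y I] sum_squared_le_sum_of_squares[of y J] by simp
  finally show ?thesis by (simp add: algebra_simps)
qed

definition block_sum :: "'a set \<Rightarrow> ('b \<Rightarrow> real) \<Rightarrow> ('a \<Rightarrow> 'b) \<Rightarrow> real" where
  "block_sum I Y p = (\<Sum>i\<in>I. Y (p i))"

section \<open>Moment generating function and tail of a block sum\<close>

context
  fixes I J :: "'a set" and Y :: "'a \<Rightarrow> real"
  assumes fin: "finite I" "finite J" and disj: "I \<inter> J = {}"
    and nonempty: "I \<noteq> {}" and centred: "(\<Sum>i\<in>I \<union> J. Y i) = 0"
begin

lemma sum_permuted_blocks:
  fixes f :: "'a \<Rightarrow> real"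
  assumes "p permutes I \<union> J"
  shows "(\<Sum>i\<in>I. f (p i)) + (\<Sum>j\<in>J. f (p j)) = (\<Sum>i\<in>I \<union> J. f i)"
proof -
  have "(\<Sum>i\<in>I. f (p i)) + (\<Sum>j\<in>J. f (p j)) = (\<Sum>i\<in>I \<union> J. f (p i))"
    using fin disj by (simp add: sum.union_disjoint)
  also have "\<dots> = (\<Sum>i\<in>I \<union> J. f i)"
    using sum.permute[OF assms, of f] by (simp add: comp_def)
  finally show ?thesis .
qed

lemma block_sum_transpose:
  assumes "i \<in> I" "j \<in> J"
  shows "block_sum I Y (p \<circ> Transposition.transpose i j) = block_sum I Y p - (Y (p i) - Y (p j))"
proof -
  have "j \<notin> I" using assms disj by auto
  then have "(\<Sum>k\<in>I - {i}. Y (p (Transposition.transpose i j k))) = (\<Sum>k\<in>I - {i}. Y (p k))"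
    by (intro sum.cong) (auto simp: Transposition.transpose_def)
  then show ?thesis
    using assms fin by (simp add: block_sum_def sum.remove[of I i])
qed

text \<open>The differential inequality for the moment generating function, scaled by the number of
  permutations: the left side is its derivative at \<open>l\<close>. A bound for each single swap
  (i, j) is summed over all pairs, which produces a common factor \<open>n\<close> on both
  sides.\<close>

lemma sum_block_sum_exp_le:
  assumes "0 \<le> l"
  shows "(\<Sum>p | p permutes I \<union> J. block_sum I Y p * exp (l * block_sum I Y p))
    \<le> l * (\<Sum>i\<in>I \<union> J. (Y i)\<^sup>2) / 2 * (\<Sum>p | p permutes I \<union> J. exp (l * block_sum I Y p))"
proof -
  define P where "P = {p. p permutes I \<union> J}"
  define n where "n = real (card I) + real (card J)"
  define V where "V = (\<Sum>i\<in>I \<union> J. (Y i)\<^sup>2)"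
  define S where "S = block_sum I Y"
  define D where "D = (\<lambda>i j (p :: 'a \<Rightarrow> 'a). Y (p i) - Y (p j))"
  have n: "0 < n" using fin nonempty by (simp add: n_def card_gt_0_iff add_pos_nonneg)
  have D_swap: "D i j (p \<circ> Transposition.transpose i j) = - D i j p" for i j p
    by (simp add: D_def)
  have S_swap: "S (p \<circ> Transposition.transpose i j) = S p - D i j p" if "i \<in> I" "j \<in> J" for i j p
    using block_sum_transpose[OF that] by (simp add: S_def D_def)
  have swap: "(\<Sum>p\<in>P. g (p \<circ> Transposition.transpose i j)) = (\<Sum>p\<in>P. g p)"
    if "i \<in> I" "j \<in> J" for i j and g :: "('a \<Rightarrow> 'a) \<Rightarrow> real"
    unfolding P_def using that by (intro sum_permutes_transpose) auto
  \<comment> \<open>The swap turns \<open>D\<close> into -\<open>D\<close> and \<open>S\<close> into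
    \<open>S\<close> - \<open>D\<close>. Averaging the sum with its swapped form creates a
    difference of exponentials, controlled by \<open>diff_mult_exp_diff_le\<close>; a second swap
    merges the two resulting terms.\<close>
  have step: "(\<Sum>p\<in>P. D i j p * exp (l * S p)) \<le> l / 2 * (\<Sum>p\<in>P. (D i j p)\<^sup>2 * exp (l * S p))"
    if ij: "i \<in> I" "j \<in> J" for i j
  proof -
    have "(\<Sum>p\<in>P. D i j p * exp (l * S p)) = - (\<Sum>p\<in>P. D i j p * exp (l * (S p - D i j p)))"
      using swap[OF ij, of "\<lambda>p. D i j p * exp (l * S p)"]
      by (simp add: D_swap S_swap[OF ij] sum_negf)
    then have "2 * (\<Sum>p\<in>P. D i j p * exp (l * S p))
        = (\<Sum>p\<in>P. D i j p * (exp (l * S p) - exp (l * (S p - D i j p))))"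
      by (simp add: algebra_simps sum_subtractf)
    also have "\<dots> \<le> (\<Sum>p\<in>P. l / 2 * ((D i j p)\<^sup>2 * (exp (l * S p) + exp (l * (S p - D i j p)))))"
    proof (rule sum_mono)
      fix p
      show "D i j p * (exp (l * S p) - exp (l * (S p - D i j p)))
          \<le> l / 2 * ((D i j p)\<^sup>2 * (exp (l * S p) + exp (l * (S p - D i j p))))"
      \<comment> \<open>The exponential inequality at l * S and l * (S - D) carries an extra factor
        \<open>l\<close>, which cancels only if it is positive; at l = 0 both sides vanish.\<close>
      proof (cases "l = 0")
        case False
        then have "0 < l" using assms by simp
        have "l * (D i j p * (exp (l * S p) - exp (l * (S p - D i j p))))
          \<le> l * (l / 2 * ((D i j p)\<^sup>2 * (exp (l * S p) + exp (l * (S p - D i j p)))))"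
          using diff_mult_exp_diff_le[of "l * S p" "l * (S p - D i j p)"]
          by (simp add: right_diff_distrib power2_eq_square mult_ac)
        then show ?thesis using \<open>0 < l\<close> by (simp only: mult_le_cancel_left_pos)
      qed simp
    qed
    also have "\<dots> = l / 2 * ((\<Sum>p\<in>P. (D i j p)\<^sup>2 * exp (l * S p))
        + (\<Sum>p\<in>P. (D i j p)\<^sup>2 * exp (l * (S p - D i j p))))"
      by (simp only: sum.distrib distrib_left sum_distrib_left)
    also have "(\<Sum>p\<in>P. (D i j p)\<^sup>2 * exp (l * (S p - D i j p))) = (\<Sum>p\<in>P. (D i j p)\<^sup>2 * exp (l * S p))"
      using swap[OF ij, of "\<lambda>p. (D i j p)\<^sup>2 * exp (l * S p)"]
      by (simp add: D_swap S_swap[OF ij])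
    finally show ?thesis by simp
  qed
  have blocks: "(\<Sum>i\<in>I. Y (p i)) + (\<Sum>j\<in>J. Y (p j)) = 0" if "p \<in> P" for p
    using sum_permuted_blocks[of p Y] that centred by (simp add: P_def)
  have D_sum: "(\<Sum>i\<in>I. \<Sum>j\<in>J. D i j p) = n * S p" if "p \<in> P" for p
    using sum_sum_diff[of "\<lambda>i. Y (p i)", OF blocks[OF that]]
    by (simp add: D_def n_def S_def block_sum_def)
  have D2_sum: "(\<Sum>i\<in>I. \<Sum>j\<in>J. (D i j p)\<^sup>2) \<le> n * V" if "p \<in> P" for p
    using sum_sum_diff_squared_le[of I J "\<lambda>i. Y (p i)", OF fin blocks[OF that]]
      sum_permuted_blocks[of p "\<lambda>x. (Y x)\<^sup>2"] that
    by (simp add: D_def n_def V_def P_def)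
  have exchange: "(\<Sum>i\<in>I. \<Sum>j\<in>J. \<Sum>p\<in>P. h i j p * exp (l * S p))
      = (\<Sum>p\<in>P. (\<Sum>i\<in>I. \<Sum>j\<in>J. h i j p) * exp (l * S p))" for h
    by (simp add: sum_distrib_right sum.swap[where A = J and B = P] sum.swap[where A = I and B = P])
  have "n * (\<Sum>p\<in>P. S p * exp (l * S p)) = (\<Sum>p\<in>P. (\<Sum>i\<in>I. \<Sum>j\<in>J. D i j p) * exp (l * S p))"
    by (simp add: D_sum sum_distrib_left mult.assoc)
  also have "\<dots> = (\<Sum>i\<in>I. \<Sum>j\<in>J. \<Sum>p\<in>P. D i j p * exp (l * S p))"
    by (rule exchange[symmetric])
  also have "\<dots> \<le> (\<Sum>i\<in>I. \<Sum>j\<in>J. l / 2 * (\<Sum>p\<in>P. (D i j p)\<^sup>2 * exp (l * S p)))"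
    by (intro sum_mono step)
  also have "\<dots> = l / 2 * (\<Sum>p\<in>P. (\<Sum>i\<in>I. \<Sum>j\<in>J. (D i j p)\<^sup>2) * exp (l * S p))"
    by (simp only: exchange flip: sum_distrib_left)
  also have "\<dots> \<le> l / 2 * (\<Sum>p\<in>P. n * V * exp (l * S p))"
    using assms D2_sum by (intro mult_left_mono sum_mono mult_right_mono) auto
  also have "\<dots> = n * (l * V / 2 * (\<Sum>p\<in>P. exp (l * S p)))"
    by (simp flip: sum_distrib_left)
  finally show ?thesis
    using n by (simp add: P_def V_def S_def)
qed

text \<open>A Gronwall argument: the differential inequality makes \<open>?G\<close>, the quotient
  of \<open>?F\<close> by the claimed growth factor, nonincreasing on the nonnegative axis, and
  \<open>?G 0\<close> counts the permutations.\<close>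

lemma sum_exp_block_sum_le:
  assumes "0 \<le> l"
  shows "(\<Sum>p | p permutes I \<union> J. exp (l * block_sum I Y p))
    \<le> fact (card (I \<union> J)) * exp (l\<^sup>2 * (\<Sum>i\<in>I \<union> J. (Y i)\<^sup>2) / 4)"
proof -
  define P where "P = {p. p permutes I \<union> J}"
  define V where "V = (\<Sum>i\<in>I \<union> J. (Y i)\<^sup>2)"
  let ?F = "\<lambda>l. \<Sum>p\<in>P. exp (l * block_sum I Y p)"
  let ?F' = "\<lambda>l. \<Sum>p\<in>P. block_sum I Y p * exp (l * block_sum I Y p)"
  let ?G = "\<lambda>l. ?F l * exp (- (l\<^sup>2 * V / 4))"
  have "?G l \<le> ?G 0"
  proof (rule DERIV_nonpos_imp_nonincreasing[OF assms])
    fix x :: real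
    assume "0 \<le> x"
    then have "?F' x - x * V / 2 * ?F x \<le> 0"
      using sum_block_sum_exp_le by (simp add: P_def V_def)
    then have "(?F' x - x * V / 2 * ?F x) * exp (- (x\<^sup>2 * V / 4)) \<le> 0"
      by (simp add: mult_nonpos_nonneg)
    moreover have "(?F has_real_derivative ?F' x) (at x)"
      by (rule DERIV_sum) (auto intro!: derivative_eq_intros)
    then have "(?G has_real_derivative
        (?F' x - x * V / 2 * ?F x) * exp (- (x\<^sup>2 * V / 4))) (at x)"
      by (rule derivative_eq_intros) (auto intro!: derivative_eq_intros simp: algebra_simps)
    ultimately show "\<exists>y. (?G has_real_derivative y) (at x) \<and> y \<le> 0"
      by blast
  qed
  also have "?G 0 = fact (card (I \<union> J))"
    using fin by (simp add: P_def card_permutations)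
  finally show ?thesis
    by (simp add: P_def V_def exp_minus field_simps)
qed

lemma prob_block_sum_ge:
  assumes "0 \<le> u" and V: "0 < (\<Sum>i\<in>I \<union> J. (Y i)\<^sup>2)"
  shows "measure_pmf.prob (pmf_of_set {p. p permutes I \<union> J}) {p. u \<le> block_sum I Y p}
    \<le> exp (- (u\<^sup>2 / (\<Sum>i\<in>I \<union> J. (Y i)\<^sup>2)))"
proof -
  define P where "P = {p. p permutes I \<union> J}"
  define V where "V = (\<Sum>i\<in>I \<union> J. (Y i)\<^sup>2)"
  \<comment> \<open>This is the minimiser of the Chernoff exponent l^2 V / 4 - l u, with minimum
    -u^2 / V.\<close>
  define l where "l = 2 * u / V"
  have V0: "0 < V" using V by (simp add: V_def)
  have l: "0 \<le> l" using V0 assms by (simp add: l_def)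
  have P: "finite P" "P \<noteq> {}" "card P = fact (card (I \<union> J))"
    using fin permutes_id[of "I \<union> J"]
    by (auto simp: P_def finite_permutations card_permutations simp del: permutes_id)
  have "real (card (P \<inter> {p. u \<le> block_sum I Y p})) * exp (l * u)
      = (\<Sum>p\<in>P \<inter> {p. u \<le> block_sum I Y p}. exp (l * u))"
    by simp
  also have "\<dots> \<le> (\<Sum>p\<in>P \<inter> {p. u \<le> block_sum I Y p}. exp (l * block_sum I Y p))"
    using l by (intro sum_mono) (auto intro: mult_left_mono)
  also have "\<dots> \<le> (\<Sum>p\<in>P. exp (l * block_sum I Y p))"
    using P by (intro sum_mono2) auto
  also have "\<dots> \<le> card P * exp (l\<^sup>2 * V / 4)"
    using sum_exp_block_sum_le[OF l] P by (simp add: P_def V_def)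
  also have "l\<^sup>2 * V / 4 = - (u\<^sup>2 / V) + l * u"
    using V0 by (simp add: l_def power2_eq_square field_simps)
  finally have "real (card (P \<inter> {p. u \<le> block_sum I Y p})) \<le> card P * exp (- (u\<^sup>2 / V))"
    by (simp only: exp_add mult_le_cancel_right_pos[OF exp_gt_zero] flip: mult.assoc)
  then show ?thesis
    using P card_gt_0_iff[of P]
    by (simp add: measure_pmf_of_set field_simps flip: P_def V_def)
qed

end

section \<open>Reduction of the standardised statistic to a block sum, and comparison of
  constants\<close>

theorem theorem2p1:
  fixes m1 m2 n :: nat and \<kappa> t :: real and X :: "nat \<Rightarrow> real"
  assumes "m1 \<ge> 1" and "m2 \<ge> 1" and "n = m1 + m2"
    and "\<kappa> \<ge> 1" and "real m1 = \<kappa> * real m2"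
    and "sample_sd n X > 0"
    and "t \<ge> 0"
  shows "measure_pmf.prob (uniform_perm n) {p. perm_stat m1 m2 X p \<ge> t}
           \<le> exp (- (real n * t\<^sup>2 / (2 * real_of_int \<lceil>\<kappa> + 1\<rceil> ^ 3)))"
proof -
  define s where "s = sample_sd n X"
  define Y where "Y = (\<lambda>i. X i - sample_mean n X)"
  define I where "I = {1..m1}"
  define J where "J = {m1 + 1..m1 + m2}"
  define V where "V = (\<Sum>i\<in>I \<union> J. (Y i)\<^sup>2)"
  define u where "u = t * s * m1 * m2 / n"
  have IJ: "I \<union> J = {1..n}" "finite I" "finite J" "I \<inter> J = {}" "I \<noteq> {}"
    using assms by (auto simp: I_def J_def)
  have s: "0 < s" using assms by (simp add: s_def)
  have n: "1 < real n" "real n = (\<kappa> + 1) * m2" using assms by (auto simp: algebra_simps)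
  have centred: "(\<Sum>i\<in>I \<union> J. Y i) = 0"
    using n(1) by (simp add: IJ Y_def sum_subtractf sample_mean_def)
  have "s\<^sup>2 = (1 / (real n - 1)) * V"
    unfolding s_def sample_sd_def V_def IJ Y_def
    using n(1) by (intro real_sqrt_pow2) (auto intro!: sum_nonneg divide_nonneg_nonneg)
  then have V: "V = (real n - 1) * s\<^sup>2" using n by simp
  then have V_pos: "0 < V" using n s by simp
  \<comment> \<open>Centring shifts both block means equally, and the centred block sums are
    opposite, so the difference of means is the first sum times 1/m1 + 1/m2 = n / (m1 m2).\<close>
  have stat: "perm_stat m1 m2 X p = n * block_sum I Y p / (m1 * m2 * s)"
    if p: "p permutes {1..n}" for p
  proof -
    have "block_sum I Y p + (\<Sum>j\<in>J. Y (p j)) = 0"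
      using sum_permuted_blocks[OF IJ(2-5) centred, of p Y] p centred
      by (simp add: IJ block_sum_def)
    moreover have "block_sum I Y p = (\<Sum>i\<in>I. X (p i)) - m1 * sample_mean n X"
      by (simp add: block_sum_def Y_def sum_subtractf I_def)
    moreover have "(\<Sum>j\<in>J. Y (p j)) = (\<Sum>j\<in>J. X (p j)) - m2 * sample_mean n X"
      by (simp add: Y_def sum_subtractf J_def)
    ultimately have "(\<Sum>i\<in>I. X (p i)) = block_sum I Y p + m1 * sample_mean n X"
      "(\<Sum>j\<in>J. X (p j)) = - block_sum I Y p + m2 * sample_mean n X"
      by auto
    then have "perm_stat m1 m2 X p = 1 / s * (1 / m1 * (block_sum I Y p + m1 * sample_mean n X)
        - 1 / m2 * (- block_sum I Y p + m2 * sample_mean n X))"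
      using assms(3) by (simp add: perm_stat_def I_def J_def s_def)
    then show ?thesis
      using assms(1-3) s by (simp add: field_simps)
  qed
  have "measure_pmf.prob (uniform_perm n) {p. perm_stat m1 m2 X p \<ge> t}
      = measure_pmf.prob (pmf_of_set {p. p permutes I \<union> J}) {p. u \<le> block_sum I Y p}"
  proof -
    have "{p. p permutes {1..n}} \<noteq> {}" "finite {p. p permutes {1..n}}"
      using permutes_id[of "{1..n}"] by (auto simp: finite_permutations simp del: permutes_id)
    moreover have "t \<le> perm_stat m1 m2 X p \<longleftrightarrow> u \<le> block_sum I Y p" if "p permutes {1..n}" for p
      using assms n s by (simp add: stat[OF that] u_def field_simps)
    \<comment> \<open>\<open>stat\<close> is available for permutations, that is, on the support, so
      the two events are compared almost everywhere.\<close>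
    ultimately show ?thesis
      unfolding uniform_perm_def IJ by (intro measure_pmf.finite_measure_eq_AE) (auto simp: AE_measure_pmf_iff)
  qed
  also have "\<dots> \<le> exp (- (u\<^sup>2 / V))"
    using prob_block_sum_ge[OF IJ(2-5) centred, of u] V_pos s assms
    by (simp add: V_def u_def)
  \<comment> \<open>Since u = t s n \<kappa> / (\<kappa> + 1)^2 and V = (n - 1) s^2, the exponent
    u^2 / V is n t^2 \<kappa>^2 / (\<kappa> + 1)^4 times n / (n - 1). The chain drops the ceiling,
    uses (\<kappa> + 1) / 2 \<le> \<kappa>^2, and then inserts the factor n / (n - 1) \<ge>
    1.\<close>
  also have "\<dots> \<le> exp (- (real n * t\<^sup>2 / (2 * real_of_int \<lceil>\<kappa> + 1\<rceil> ^ 3)))"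
  proof -
    have "0 < real_of_int \<lceil>\<kappa> + 1\<rceil>"
      using assms(4) le_of_int_ceiling[of "\<kappa> + 1"] by linarith
    then have "real n * t\<^sup>2 / (2 * real_of_int \<lceil>\<kappa> + 1\<rceil> ^ 3) \<le> real n * t\<^sup>2 / (2 * (\<kappa> + 1) ^ 3)"
      using assms by (intro divide_left_mono mult_left_mono power_mono mult_pos_pos) auto
    also have "\<dots> = real n * t\<^sup>2 / (\<kappa> + 1) ^ 4 * ((\<kappa> + 1) / 2)"
      using assms by (simp add: eval_nat_numeral)
    also have "\<dots> \<le> real n * t\<^sup>2 / (\<kappa> + 1) ^ 4 * \<kappa>\<^sup>2"
    proof -
      have "0 \<le> (2 * \<kappa> + 1) * (\<kappa> - 1)" using assms by simp
      then have "(\<kappa> + 1) / 2 \<le> \<kappa>\<^sup>2" by (simp add: power2_eq_square algebra_simps)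
      then show ?thesis using assms by (intro mult_left_mono) auto
    qed
    also have "\<dots> = (real n * t\<^sup>2 / (\<kappa> + 1) ^ 4 * \<kappa>\<^sup>2) * 1" by simp
    also have "\<dots> \<le> (real n * t\<^sup>2 / (\<kappa> + 1) ^ 4 * \<kappa>\<^sup>2) * (n / (real n - 1))"
      using n(1) assms(4) by (intro mult_left_mono) auto
    also have "\<dots> = u\<^sup>2 / V"
    proof -
      have "u = t * s * n * (\<kappa> / (\<kappa> + 1)\<^sup>2)"
        using assms(2,4) unfolding u_def n(2) assms(5) by (simp add: power2_eq_square)
      then show ?thesis
        using s n by (simp add: V power_mult_distrib power_divide power2_eq_square eval_nat_numeral mult_ac)
    qed
    finally show ?thesis by simp
  qed
  finally show ?thesis .
qed

end
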